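(* For the three-user Gaussian interference channel with delayed CSIT, the sum linear degrees of freedom satisfies $\mathrm{DoF}_{\mathrm{L\text{-}sum}}=\max\{d_1+d_2+d_3:(d_1,d_2,d_3)\in\mathcal D_{\mathrm{3UserIC}}\}\le\frac97$.
   Context: Three single-antenna transmitters $\mathrm{Tx}_1,\mathrm{Tx}_2,\mathrm{Tx}_3$ and receivers $\mathrm{Rx}_1,\mathrm{Rx}_2,\mathrm{Rx}_3$; $\mathrm{Tx}_j$ has a message only for $\mathrm{Rx}_j$. At time $t$, $\mathbf y_k(t)=\sum_{j=1}^3\mathbf g_{kj}(t)\mathbf x_j(t)+\mathbf z_k(t)$, $\mathbf z_k(t)\sim\mathcal{CN}(0,1)$, with complex channel coefficients $\mathbf g_{kj}(t)$ i.i.d. across time and users from a continuous distribution. Let $\mathcal G^t=\{\mathbf g_{kj}(s):k,j\in\{1,2,3\},s\le t\}$. Delayed CSIT: at time $t$ transmitters know only $\mathcal G^{t-1}$; receivers know $\mathcal G^t$. Linear scheme of block length $n$: $\mathrm{Tx}_j$ has $\vec{\mathbf x}_j\in\mathbb C^{m_j(n)}$ information symbols and sends $\mathbf x_j(t)=\vec{\mathbf v}_j(t)^\top\vec{\mathbf x}_j$, where $\vec{\mathbf v}_j(t)\in\mathbb C^{m_j(n)}$ is a deterministic function of $\mathcal G^{t-1}$. Let $\mathbf V^n_j\in\mathbb C^{n\times m_j(n)}$ have $t$-th row $\vec{\mathbf v}_j(t)^\top$, and $\mathbf G^n_{kj}$ be the $n\times n$ diagonal matrix with $t$-th diagonal entry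 $\mathbf g_{kj}(t)$. Let $\mathcal I_j=\bigcup_{i\ne j}\mathrm{colspan}(\mathbf G^n_{ji}\mathbf V^n_i)$ with orthogonal complement $\mathcal I_j^c\subseteq\mathbb C^n$. Decodability: $\dim(\mathrm{Proj}_{\mathcal I_j^c}\mathrm{colspan}(\mathbf G^n_{jj}\mathbf V^n_j))=\dim(\mathrm{colspan}(\mathbf V^n_j))=m_j(n)$ for $j=1,2,3$. A triple $(d_1,d_2,d_3)$ is linearly achievable if there is a sequence of such linear schemes such that for every $n$ decodability holds with probability 1 and $d_j=\lim_{n\to\infty}m_j(n)/n$; $\mathcal D_{\mathrm{3UserIC}}$ is the closure of the set of linearly achievable triples. *)

theory Defs
  imports "HOL-Probability.Probability" "HOL-Library.Function_Algebras"
begin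

text \<open>Vectors of \<open>\<complex>^n\<close> are represented as functions \<open>nat \<Rightarrow> complex\<close> vanishing
  outside \<open>{..<n}\<close> (time index \<open>t = 0..n-1\<close>). Users/transmitters/receivers are indexed
  by \<open>0,1,2\<close>. A channel realisation over a block of length \<open>n\<close> is a function
  \<open>g\<close> with \<open>g (t,k,j)\<close> the coefficient \<open>g_kj(t)\<close>.\<close>

type_synonym chan = "nat \<times> nat \<times> nat \<Rightarrow> complex"

text \<open>A linear scheme of block length \<open>n\<close>: \<open>V j t g i\<close> is the \<open>i\<close>-th entry of the
  beamforming vector \<open>v_j(t)\<close> (as a function of the channel realisation g).\<close>
type_synonym scheme = "nat \<Rightarrow> nat \<Rightarrow> chan \<Rightarrow> nat \<Rightarrow> complex"

definition cscale :: "complex \<Rightarrow> (nat \<Rightarrow> complex) \<Rightarrow> (nat \<Rightarrow> complex)" where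
  "cscale c x = (\<lambda>t. c * x t)"

global_interpretation cv: vector_space cscale
  defines cspan = cv.span and cdim = cv.dim
  by unfold_locales (auto simp: cscale_def fun_eq_iff algebra_simps)

definition cvec :: "nat \<Rightarrow> (nat \<Rightarrow> complex) set" where
  "cvec n = {x. \<forall>t\<ge>n. x t = 0}"

definition cinner :: "nat \<Rightarrow> (nat \<Rightarrow> complex) \<Rightarrow> (nat \<Rightarrow> complex) \<Rightarrow> complex" where
  "cinner n x y = (\<Sum>t<n. x t * cnj (y t))"

definition orth_compl :: "nat \<Rightarrow> (nat \<Rightarrow> complex) set \<Rightarrow> (nat \<Rightarrow> complex) set" where
  "orth_compl n S = {y \<in> cvec n. \<forall>x\<in>S. cinner n y x = 0}"

definition proj :: "nat \<Rightarrow> (nat \<Rightarrow> complex) set \<Rightarrow> (nat \<Rightarrow> complex) \<Rightarrow> (nat \<Rightarrow> complex)" where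
  "proj n S x = (THE y. y \<in> S \<and> (\<forall>z\<in>S. cinner n (x - y) z = 0))"

definition enc_col :: "nat \<Rightarrow> scheme \<Rightarrow> chan \<Rightarrow> nat \<Rightarrow> nat \<Rightarrow> (nat \<Rightarrow> complex)" where
  "enc_col n V g j i = (\<lambda>t. if t < n then V j t g i else 0)"

definition rx_col :: "nat \<Rightarrow> scheme \<Rightarrow> chan \<Rightarrow> nat \<Rightarrow> nat \<Rightarrow> nat \<Rightarrow> (nat \<Rightarrow> complex)" where
  "rx_col n V g k j i = (\<lambda>t. if t < n then g (t, k, j) * V j t g i else 0)"

definition colspan_V :: "nat \<Rightarrow> (nat \<Rightarrow> nat) \<Rightarrow> scheme \<Rightarrow> chan \<Rightarrow> nat \<Rightarrow> (nat \<Rightarrow> complex) set" where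
  "colspan_V n m V g j = cspan {enc_col n V g j i | i. i < m j}"

definition colspan_GV :: "nat \<Rightarrow> (nat \<Rightarrow> nat) \<Rightarrow> scheme \<Rightarrow> chan \<Rightarrow> nat \<Rightarrow> nat \<Rightarrow> (nat \<Rightarrow> complex) set" where
  "colspan_GV n m V g k j = cspan {rx_col n V g k j i | i. i < m j}"

definition interf :: "nat \<Rightarrow> (nat \<Rightarrow> nat) \<Rightarrow> scheme \<Rightarrow> chan \<Rightarrow> nat \<Rightarrow> (nat \<Rightarrow> complex) set" where
  "interf n m V g j = (\<Union>i\<in>{0,1,2} - {j}. colspan_GV n m V g j i)"

definition decodable :: "nat \<Rightarrow> (nat \<Rightarrow> nat) \<Rightarrow> scheme \<Rightarrow> chan \<Rightarrow> bool" where
  "decodable n m V g \<longleftrightarrow> (\<forall>j<3.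
     cdim (proj n (orth_compl n (interf n m V g j)) ` colspan_GV n m V g j j)
       = cdim (colspan_V n m V g j)
     \<and> cdim (colspan_V n m V g j) = m j)"

definition delayed_csit :: "nat \<Rightarrow> scheme \<Rightarrow> bool" where
  "delayed_csit n V \<longleftrightarrow> (\<forall>j<3. \<forall>t<n. \<forall>g g'.
     (\<forall>s<t. \<forall>k<3. \<forall>i<3. g (s, k, i) = g' (s, k, i)) \<longrightarrow> V j t g = V j t g')"

definition chan_measure :: "complex measure \<Rightarrow> nat \<Rightarrow> chan measure" where
  "chan_measure \<mu> n = PiM ({..<n} \<times> {..<3} \<times> {..<3}) (\<lambda>_. \<mu>)"

definition lin_achievable :: "complex measure \<Rightarrow> real \<times> real \<times> real \<Rightarrow> bool" where
  "lin_achievable \<mu> d \<longleftrightarrow> (\<exists>(m :: nat \<Rightarrow> nat \<Rightarrow> nat) (V :: nat \<Rightarrow> scheme).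
     (\<forall>n. delayed_csit n (V n) \<and> (AE g in chan_measure \<mu> n. decodable n (m n) (V n) g))
     \<and> (\<lambda>n. real (m n 0) / real n) \<longlonglongrightarrow> fst d
     \<and> (\<lambda>n. real (m n 1) / real n) \<longlonglongrightarrow> fst (snd d)
     \<and> (\<lambda>n. real (m n 2) / real n) \<longlonglongrightarrow> snd (snd d))"

definition D_3UserIC :: "complex measure \<Rightarrow> (real \<times> real \<times> real) set" where
  "D_3UserIC \<mu> = closure {d. lin_achievable \<mu> d}"

end

theory Submission
  imports Defs
begin

text \<open>
  Fix a receiver \<open>k\<close> with interferers \<open>i, j\<close>, whose signal spaces \<open>U\<^sub>i, U\<^sub>j \<subseteq> \<complex>\<^sup>n\<close> have dimensions
  \<open>m\<^sub>i, m\<^sub>j\<close>. Let \<open>D\<close> be the dimension of the interference \<open>G\<^sub>k\<^sub>i U\<^sub>i + G\<^sub>k\<^sub>j U\<^sub>j\<close>; its overlap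
  \<open>P = G\<^sub>k\<^sub>i U\<^sub>i \<inter> G\<^sub>k\<^sub>j U\<^sub>j\<close> has dimension at least \<open>m\<^sub>i + m\<^sub>j - D\<close>. Let \<open>N\<close> be the set of times at which
  receiver \<open>k\<close> observes something new about the interference. Echelon form gives \<open>|N| \<le> D\<close>.
  Since the coefficients at time \<open>t\<close> are unknown when the beamforming vectors are chosen, generically
  at a time outside \<open>N\<close> both transmitted values vanish on every pair of signals that receiver \<open>k\<close>
  has so far observed as \<open>0\<close>; hence \<open>P\<close> is supported on \<open>N\<close>. Receiver \<open>j\<close>
  separates \<open>U\<^sub>i\<close> from \<open>U\<^sub>j\<close>, so it sees two independent copies of \<open>P\<close>, both supported on \<open>N\<close>, and
  \<open>2 dim P \<le> |N| \<le> D\<close>. Therefore \<open>2 (m\<^sub>i + m\<^sub>j) \<le> 3 D \<le> 3 (n - m\<^sub>k)\<close>, and summing over \<open>k\<close>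
  yields \<open>7 (m\<^sub>0 + m\<^sub>1 + m\<^sub>2) \<le> 9 n\<close>.

  The beamforming vectors need not depend measurably on the channel, so genericity cannot be stated
  as an almost sure event. It suffices to find a single realisation that is decodable and
  generic, and this is done by choosing the coefficients one at a time.
\<close>

section \<open>Dimensions of subspaces\<close>

context vector_space
begin

text \<open>The functions \<open>nat \<Rightarrow> complex\<close> form an infinite-dimensional
  space, so finite dimensionality is carried as containment in the span of a finite set
  \<open>F\<close>.\<close>

lemma finite_basis_exists:
  assumes "S \<subseteq> span F" "finite F"
  obtains B where "B \<subseteq> S" "independent B" "S \<subseteq> span B" "card B = dim S" "finite B"
proof -
  obtain B where B: "B \<subseteq> S" "independent B" "S \<subseteq> span B" "card B = dim S"
    using basis_exists by blast
  moreover have "finite B"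
    using independent_span_bound[OF assms(2) B(2)] B(1) assms(1) by blast
  ultimately show thesis using that by blast
qed

lemma dim_mono_finite:
  assumes "S \<subseteq> T" "T \<subseteq> span F" "finite F"
  shows "dim S \<le> dim T"
proof -
  obtain B where "B \<subseteq> T" "T \<subseteq> span B" "card B = dim T" "finite B"
    using finite_basis_exists[OF assms(2,3)] by metis
  then show ?thesis
    using dim_le_card[of S B] assms(1) by auto
qed

text \<open>Extend a basis \<open>B\<close> of \<open>S\<close> by vectors \<open>D\<close> of
  \<open>T\<close> until \<open>T\<close> is spanned too. Then \<open>B \<union> D\<close> is
  independent inside the sum, and a basis of \<open>S \<inter> T\<close> together with
  \<open>D\<close> spans \<open>T\<close>: subtracting the \<open>D\<close>-part of a vector of
  \<open>T\<close> leaves a vector in both subspaces.\<close>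

lemma dim_add_le_dim_sum_Int:
  assumes S: "subspace S" and T: "subspace T" and F: "S \<union> T \<subseteq> span F" "finite F"
  shows "dim S + dim T \<le> dim {x + y | x y. x \<in> S \<and> y \<in> T} + dim (S \<inter> T)"
proof -
  let ?W = "{x + y | x y. x \<in> S \<and> y \<in> T}"
  obtain B where B: "B \<subseteq> S" "independent B" "S \<subseteq> span B" "card B = dim S" "finite B"
    using finite_basis_exists[of S F] F by auto
  obtain E where E: "B \<subseteq> E" "E \<subseteq> B \<union> T" "independent E" "B \<union> T \<subseteq> span E"
    using maximal_independent_subset_extend[of B "B \<union> T"] B by auto
  have "E \<subseteq> span F" using E(2) B(1) F(1) by auto
  then have fE: "finite E" using independent_span_bound[OF F(2) E(3)] by blast
  define D where "D = E - B"
  have D: "D \<subseteq> T" "finite D" "E = B \<union> D" using E fE by (auto simp: D_def)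
  have cE: "card E = dim S + card D"
    using B(4,5) fE E(1) card_mono[OF fE E(1)] by (simp add: D_def card_Diff_subset)
  have WF: "?W \<subseteq> span F" using F(1) by (auto intro!: span_add)
  have "0 \<in> S" "0 \<in> T" using S T subspace_0 by auto
  have "E \<subseteq> ?W"
  proof
    fix e assume "e \<in> E"
    then consider "e \<in> S" | "e \<in> T" using D B by auto
    then show "e \<in> ?W"
      using \<open>0 \<in> S\<close> \<open>0 \<in> T\<close> by cases (metis (mono_tags, lifting) add_0 add_0_right mem_Collect_eq)+
  qed
  then have "dim E \<le> dim ?W" using WF F(2) by (rule dim_mono_finite)
  then have 1: "dim S + card D \<le> dim ?W"
    using cE E(3) by (simp add: dim_eq_card_independent)
  obtain C where C: "C \<subseteq> S \<inter> T" "S \<inter> T \<subseteq> span C" "card C = dim (S \<inter> T)" "finite C"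
    using finite_basis_exists[of "S \<inter> T" F] F by (metis le_infI1 le_sup_iff)
  have "T \<subseteq> span (C \<union> D)"
  proof
    fix t assume t: "t \<in> T"
    then have "t \<in> span (B \<union> D)" using E D by auto
    then obtain x y where xy: "t = x + y" "x \<in> span B" "y \<in> span D"
      unfolding span_Un by auto
    have "x \<in> S" using xy(2) B(1) S span_minimal by blast
    have "y \<in> T" using xy(3) D(1) T span_minimal by blast
    then have "x \<in> T" using subspace_diff[OF T t \<open>y \<in> T\<close>] xy(1) by simp
    then show "t \<in> span (C \<union> D)"
      using \<open>x \<in> S\<close> C(2) xy unfolding span_Un by blast
  qed
  then have "dim T \<le> card (C \<union> D)" using C D by (intro dim_le_card) auto
  also have "\<dots> \<le> dim (S \<inter> T) + card D" using card_Un_le[of C D] C by simp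
  finally show ?thesis using 1 by simp
qed

lemma dim_image_inj_on:
  assumes "Vector_Spaces.linear scale scale f" "inj_on f (span S)"
  shows "dim (f ` S) = dim S"
proof -
  interpret f: Vector_Spaces.linear scale scale f by fact
  obtain B where B: "B \<subseteq> S" "independent B" "S \<subseteq> span B" "card B = dim S"
    using basis_exists[of S] by auto
  have sp: "span S = span B" using B by (metis span_mono span_span subset_antisym)
  have "card (f ` B) = card B"
    using assms(2) span_superset[of B] by (intro card_image) (auto simp: sp intro: inj_on_subset)
  moreover have "independent (f ` B)"
    using f.dependent_inj_imageD assms(2) B(2) sp by metis
  moreover have "f ` S \<subseteq> span (f ` B)" using B(3) by (auto simp: f.span_image)
  ultimately show ?thesis
    using B(1,4) by (intro dim_unique[of "f ` B"]) auto
qed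

text \<open>A nonzero kernel vector extends to a basis of \<open>span S\<close> but contributes
  nothing to the image, which then has dimension below \<open>card S\<close>. This turns the rank
  condition of decodability into injectivity.\<close>

lemma linear_kernel_trivial_of_dim_image:
  assumes "Vector_Spaces.linear scale scale f" "finite S" "card S \<le> dim (f ` span S)"
    and "z \<in> span S" "f z = 0"
  shows "z = 0"
proof (rule ccontr)
  interpret f: Vector_Spaces.linear scale scale f by fact
  assume "z \<noteq> 0"
  then have "independent {z}" by simp
  then obtain B where B: "{z} \<subseteq> B" "B \<subseteq> span S" "independent B" "span S \<subseteq> span B"
    using maximal_independent_subset_extend[of "{z}" "span S"] assms(4) by auto
  have fin: "finite B \<and> card B \<le> card S"
    using independent_span_bound[OF assms(2) B(3)] B(2) by blast
  have "B = insert z (B - {z})" using B by auto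
  then have "span (f ` B) = span (insert 0 (f ` (B - {z})))"
    using assms(5) by (metis image_insert)
  then have "span (f ` B) = span (f ` (B - {z}))" by simp
  then have "f ` span S \<subseteq> span (f ` (B - {z}))"
    using B(4) by (metis f.span_image image_mono)
  then have "dim (f ` span S) \<le> card (f ` (B - {z}))"
    using fin by (intro dim_le_card) auto
  also have "\<dots> \<le> card (B - {z})" using fin by (intro card_image_le) auto
  also have "\<dots> < card B" using fin B(1) by (intro card_Diff1_less) auto
  finally show False using fin assms(3) by simp
qed

end

section \<open>Supports, echelon form and diagonal maps in \<open>\<complex>\<^sup>n\<close>\<close>

definition unit_vec :: "nat \<Rightarrow> nat \<Rightarrow> complex" where
  "unit_vec i = (\<lambda>t. if t = i then 1 else 0)"

lemma supported_in_span_unit_vec: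
  assumes "finite N" "\<And>t. t \<notin> N \<Longrightarrow> x t = 0"
  shows "x \<in> cspan (unit_vec ` N)"
proof -
  have "x = (\<Sum>i\<in>N. cscale (x i) (unit_vec i))"
  proof
    fix t
    have "(\<Sum>i\<in>N. cscale (x i) (unit_vec i)) t = (\<Sum>i\<in>N. cscale (x i) (unit_vec i) t)"
      using assms(1) by (induction N) auto
    also have "\<dots> = (\<Sum>i\<in>N. if t = i then x i else 0)"
      by (rule sum.cong) (auto simp: cscale_def unit_vec_def)
    also have "\<dots> = x t" using assms by auto
    finally show "x t = (\<Sum>i\<in>N. cscale (x i) (unit_vec i)) t" by simp
  qed
  also have "\<dots> \<in> cspan (unit_vec ` N)"
    by (intro cv.span_sum cv.span_scale cv.span_base) auto
  finally show ?thesis .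
qed

lemma dim_supported_le:
  assumes "finite N" "\<And>x t. x \<in> S \<Longrightarrow> t \<notin> N \<Longrightarrow> x t = 0"
  shows "cdim S \<le> card N"
proof -
  have "cdim S \<le> card (unit_vec ` N)"
    using supported_in_span_unit_vec assms by (intro cv.dim_le_card) blast+
  also have "\<dots> \<le> card N" using assms(1) by (rule card_image_le)
  finally show ?thesis .
qed

lemma cvec_finite_span: "cvec n \<subseteq> cspan (unit_vec ` {..<n})"
  by (auto simp: cvec_def intro!: supported_in_span_unit_vec intro: ccontr)

lemma dim_mono_cvec: "S \<subseteq> T \<Longrightarrow> T \<subseteq> cvec n \<Longrightarrow> cdim S \<le> cdim T"
  using cvec_finite_span[of n] cv.dim_mono_finite[of S T "unit_vec ` {..<n}"] by blast

lemma dim_add_le_cvec: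
  assumes "cv.subspace S" "cv.subspace T" "S \<subseteq> cvec n" "T \<subseteq> cvec n"
  shows "cdim S + cdim T \<le> cdim {x + y | x y. x \<in> S \<and> y \<in> T} + cdim (S \<inter> T)"
  using assms cvec_finite_span[of n]
  by (intro cv.dim_add_le_dim_sum_Int[where F = "unit_vec ` {..<n}"]) auto

lemma subspace_cvec: "cv.subspace (cvec n)"
  by (auto simp: cv.subspace_def cvec_def cscale_def)

text \<open>Insert the vectors by decreasing index: all those already present vanish at the new
  index \<open>b\<close>, where \<open>z b\<close> does not, so \<open>z b\<close> is outside their
  span.\<close>

lemma card_le_dim_echelon:
  assumes "finite N" "W \<subseteq> cvec n" "\<And>t. t \<in> N \<Longrightarrow> z t \<in> W"
    and piv: "\<And>t. t \<in> N \<Longrightarrow> z t t \<noteq> (0::complex)"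
    and low: "\<And>t s. t \<in> N \<Longrightarrow> s < t \<Longrightarrow> z t s = 0"
  shows "card N \<le> cdim W"
proof -
  have "\<not> cv.dependent (z ` M) \<and> card (z ` M) = card M" if "finite M" "M \<subseteq> N" for M
    using that
  proof (induction M rule: finite_linorder_min_induct)
    case empty
    then show ?case by (simp add: cv.independent_empty)
  next
    case (insert b A)
    have sub: "cv.subspace {x. x b = 0}"
      by (auto simp: cv.subspace_def cscale_def)
    have "cspan (z ` A) \<subseteq> {x. x b = 0}"
      using insert low by (intro cv.span_minimal[OF _ sub]) auto
    then have n: "z b \<notin> cspan (z ` A)" using piv insert by auto
    then have "z b \<notin> z ` A" using cv.span_base by blast
    moreover have "b \<notin> A" using insert by auto
    ultimately show ?case
      using insert n cv.independent_insertI[of "z b" "z ` A"] by simp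
  qed
  from this[OF assms(1)] have i: "\<not> cv.dependent (z ` N)" "card (z ` N) = card N" by auto
  have "card N = cdim (z ` N)" using i by (simp add: cv.dim_eq_card_independent)
  also have "\<dots> \<le> cdim W" using assms by (intro dim_mono_cvec) auto
  finally show ?thesis .
qed

text \<open>Pointwise multiplication is the action of a diagonal matrix, that is, of a channel on a
  transmitted signal.\<close>

lemma linear_times: "Vector_Spaces.linear cscale cscale (\<lambda>x. c * x)"
  by unfold_locales (auto simp: cscale_def fun_eq_iff algebra_simps)

lemma dim_times_image:
  assumes "\<And>t. c t \<noteq> 0"
  shows "cdim ((\<lambda>x. c * x) ` S) = cdim S"
  by (rule cv.dim_image_inj_on[OF linear_times])
     (use assms in \<open>auto simp: inj_on_def fun_eq_iff\<close>)

lemma subspace_times_image: "cv.subspace S \<Longrightarrow> cv.subspace ((\<lambda>x. c * x) ` S)"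
  using linear_times by (rule module_hom.subspace_image[OF Vector_Spaces.linear.axioms(3)])

lemma times_image_cvec: "S \<subseteq> cvec n \<Longrightarrow> (\<lambda>x. c * x) ` S \<subseteq> cvec n"
  by (auto simp: cvec_def)

section \<open>The rank ratio inequality\<close>

text \<open>Here \<open>a\<close>, \<open>b\<close> are the channels from two interferers to the
  observing receiver, and \<open>a'\<close>, \<open>b'\<close> those to a receiver that can separate
  them, as expressed by \<open>direct\<close>. The hypothesis \<open>generic\<close> concerns the
  times at which the observer learns nothing new.\<close>

lemma rank_ratio:
  fixes a b a' b' :: "nat \<Rightarrow> complex"
  assumes UA: "cv.subspace UA" "UA \<subseteq> cvec n" and UB: "cv.subspace UB" "UB \<subseteq> cvec n"
    and nz: "\<And>t. a t \<noteq> 0" "\<And>t. b t \<noteq> 0" "\<And>t. a' t \<noteq> 0" "\<And>t. b' t \<noteq> 0"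
    and direct: "\<And>x y. x \<in> UA \<Longrightarrow> y \<in> UB \<Longrightarrow> a' * x = b' * y \<Longrightarrow> x = 0"
    and generic: "\<And>t. t < n \<Longrightarrow>
      (\<forall>x\<in>UA. \<forall>y\<in>UB. (\<forall>s<t. a s * x s + b s * y s = 0) \<longrightarrow> a t * x t + b t * y t = 0) \<Longrightarrow>
      (\<forall>x\<in>UA. \<forall>y\<in>UB. (\<forall>s<t. a s * x s + b s * y s = 0) \<longrightarrow> x t = 0 \<and> y t = 0)"
  shows "2 * (cdim UA + cdim UB) \<le>
    3 * cdim {x + y | x y. x \<in> (\<lambda>x. a * x) ` UA \<and> y \<in> (\<lambda>x. b * x) ` UB}"
proof -
  define S where "S = (\<lambda>x. a * x) ` UA"
  define T where "T = (\<lambda>x. b * x) ` UB"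
  define W where "W = {x + y | x y. x \<in> S \<and> y \<in> T}"
  define P where "P = S \<inter> T"
  have S: "cv.subspace S" "S \<subseteq> cvec n" "cdim S = cdim UA"
    unfolding S_def using UA nz subspace_times_image times_image_cvec dim_times_image by blast+
  have T: "cv.subspace T" "T \<subseteq> cvec n" "cdim T = cdim UB"
    unfolding T_def using UB nz subspace_times_image times_image_cvec dim_times_image by blast+
  have W: "W \<subseteq> cvec n"
    using S(2) T(2) cv.subspace_add[OF subspace_cvec] unfolding W_def by blast
  have P: "cv.subspace P" "P \<subseteq> cvec n"
    using S T by (auto simp: P_def cv.subspace_inter)
  have 1: "cdim UA + cdim UB \<le> cdim W + cdim P"
    using dim_add_le_cvec[OF S(1) T(1) S(2) T(2)] S T by (simp add: W_def P_def)
  define K where "K t x y \<longleftrightarrow> x \<in> UA \<and> y \<in> UB \<and> (\<forall>s<t. a s * x s + b s * y s = 0)" for t x y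
  \<comment> \<open>At a time in \<open>N\<close>, some received combination has its first nonzero
    entry; choosing one for each such time gives vectors of \<open>W\<close> in echelon
    form.\<close>
  define N where "N = {t. t < n \<and> (\<exists>x y. K t x y \<and> a t * x t + b t * y t \<noteq> 0)}"
  have N: "finite N" by (simp add: N_def)
  have "\<forall>t\<in>N. \<exists>z\<in>W. z t \<noteq> 0 \<and> (\<forall>s<t. z s = 0)"
  proof
    fix t assume "t \<in> N"
    then obtain x y where "K t x y" "a t * x t + b t * y t \<noteq> 0" by (auto simp: N_def)
    then show "\<exists>z\<in>W. z t \<noteq> 0 \<and> (\<forall>s<t. z s = 0)"
      by (intro bexI[of _ "a * x + b * y"]) (auto simp: K_def W_def S_def T_def)
  qed
  then obtain z where "\<forall>t\<in>N. z t \<in> W \<and> z t t \<noteq> 0 \<and> (\<forall>s<t. z t s = 0)" by metis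
  then have 2: "card N \<le> cdim W"
    using N W by (intro card_le_dim_echelon[of N W n z]) auto
  have supp: "p t = 0" if "p \<in> P" "t \<notin> N" for p t
  proof (cases "t < n")
    case False
    then show ?thesis using that P(2) by (auto simp: cvec_def)
  next
    case True
    obtain x y where xy: "x \<in> UA" "y \<in> UB" "p = a * x" "p = b * y"
      using \<open>p \<in> P\<close> by (auto simp: P_def S_def T_def)
    \<comment> \<open>Overlap means \<open>a * x = b * y\<close>, whereas \<open>generic\<close> is
      about vanishing sums, so it is applied to \<open>x\<close> and \<open>- y\<close>.\<close>
    have "- y \<in> UB" using cv.subspace_neg[OF UB(1) xy(2)] .
    have "a s * x s + b s * (- y) s = 0" for s
      using fun_cong[OF xy(3), of s] fun_cong[OF xy(4), of s] by simp
    moreover have "\<forall>x\<in>UA. \<forall>y\<in>UB. (\<forall>s<t. a s * x s + b s * y s = 0) \<longrightarrow> x t = 0 \<and> y t = 0"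
    proof (rule generic[OF True], intro ballI impI)
      fix x y assume "x \<in> UA" "y \<in> UB" "\<forall>s<t. a s * x s + b s * y s = 0"
      then have "K t x y" by (simp add: K_def)
      then show "a t * x t + b t * y t = 0" using True \<open>t \<notin> N\<close> unfolding N_def by blast
    qed
    ultimately have "x t = 0" using xy(1) \<open>- y \<in> UB\<close> by blast
    then show ?thesis using xy(3) by simp
  qed
  \<comment> \<open>The two copies of \<open>P\<close> at the separating receiver: dividing by
    \<open>a\<close> or \<open>b\<close> recovers the transmitted signal. Diagonal maps keep the
    support inside \<open>N\<close>.\<close>
  define P1 where "P1 = (\<lambda>x. (\<lambda>t. a' t / a t) * x) ` P"
  define P2 where "P2 = (\<lambda>x. (\<lambda>t. b' t / b t) * x) ` P"
  have P1: "cv.subspace P1" "P1 \<subseteq> cvec n" "cdim P1 = cdim P"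
    unfolding P1_def using P nz
    by (auto intro!: subspace_times_image times_image_cvec dim_times_image simp del: times_fun_apply)
  have P2: "cv.subspace P2" "P2 \<subseteq> cvec n" "cdim P2 = cdim P"
    unfolding P2_def using P nz
    by (auto intro!: subspace_times_image times_image_cvec dim_times_image simp del: times_fun_apply)
  have "P1 \<inter> P2 \<subseteq> {0}"
  proof
    fix w assume "w \<in> P1 \<inter> P2"
    then obtain x y where xy: "x \<in> UA" "y \<in> UB" "w = (\<lambda>t. a' t / a t) * (a * x)"
        "w = (\<lambda>t. b' t / b t) * (b * y)"
      by (auto simp: P1_def P2_def P_def S_def T_def)
    then have "w = a' * x" "w = b' * y" using nz by (auto simp: fun_eq_iff)
    moreover from this have "x = 0" using direct xy by metis
    ultimately show "w \<in> {0}" by auto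
  qed
  then have "cdim (P1 \<inter> P2) = 0"
    using cv.dim_le_card[of "P1 \<inter> P2" "{}"] by simp
  then have "2 * cdim P \<le> cdim {x + y | x y. x \<in> P1 \<and> y \<in> P2}"
    using dim_add_le_cvec[OF P1(1) P2(1) P1(2) P2(2)] P1(3) P2(3) by simp
  also have "\<dots> \<le> card N"
    using N by (intro dim_supported_le) (auto simp: P1_def P2_def supp)
  finally have "2 * cdim P \<le> cdim W" using 2 by simp
  then have "2 * (cdim UA + cdim UB) \<le> 3 * cdim W" using 1 by simp
  then show ?thesis by (simp add: W_def S_def T_def)
qed

section \<open>Orthogonal projections and decodability\<close>

lemma cinner_diff_left: "cinner n (x - y) z = cinner n x z - cinner n y z"
  by (simp add: cinner_def algebra_simps sum_subtractf)

lemma cinner_add_left: "cinner n (x + y) z = cinner n x z + cinner n y z"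
  by (simp add: cinner_def algebra_simps sum.distrib)

lemma cinner_add_right: "cinner n z (x + y) = cinner n z x + cinner n z y"
  by (simp add: cinner_def algebra_simps sum.distrib)

lemma cinner_scale_left: "cinner n (cscale c x) z = c * cinner n x z"
  by (simp add: cinner_def cscale_def sum_distrib_left mult.assoc)

lemma cinner_scale_right: "cinner n z (cscale c x) = cnj c * cinner n z x"
  by (simp add: cinner_def cscale_def sum_distrib_left mult_ac)

lemma cinner_zero_right [simp]: "cinner n z 0 = 0"
  by (simp add: cinner_def)

lemma cinner_commute: "cinner n y x = cnj (cinner n x y)"
  by (simp add: cinner_def mult.commute)

lemma cinner_self_eq_0:
  assumes "cinner n x x = 0" "t < n"
  shows "x t = 0"
proof -
  have "complex_of_real (\<Sum>t<n. (cmod (x t))\<^sup>2) = cinner n x x"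
    unfolding cinner_def of_real_sum by (intro sum.cong refl) (simp add: complex_norm_square del: of_real_power)
  then have "(\<Sum>t<n. (cmod (x t))\<^sup>2) = 0" using assms(1) by (metis of_real_eq_0_iff)
  then show ?thesis using assms(2) by (subst (asm) sum_nonneg_eq_0_iff) auto
qed

lemma subspace_orthogonal: "cv.subspace {z. cinner n v z = 0}"
  by (auto simp: cv.subspace_def cinner_add_right cinner_scale_right)

text \<open>A Gram-Schmidt step: \<open>r\<close> is the part of \<open>b\<close> orthogonal to the
  old span, and the component of \<open>x - y\<close> along \<open>r\<close> is added. The vector
  \<open>x\<close> is arbitrary because the induction hypothesis is used for \<open>b\<close> as
  well.\<close>

lemma orthogonal_projection_exists_span:
  assumes "finite B"
  shows "\<exists>y\<in>cspan B. \<forall>z\<in>cspan B. cinner n (x - y) z = 0"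
  using assms
proof (induction B arbitrary: x)
  case empty
  show ?case by (simp add: cinner_def)
next
  case (insert b B)
  obtain p where p: "p \<in> cspan B" "\<forall>z\<in>cspan B. cinner n (b - p) z = 0" using insert by metis
  obtain y where y: "y \<in> cspan B" "\<forall>z\<in>cspan B. cinner n (x - y) z = 0" using insert by metis
  define r where "r = b - p"
  define c where "c = cinner n (x - y) r / cinner n r r"
  define y' where "y' = y + cscale c r"
  have sub: "cspan B \<subseteq> cspan (insert b B)" by (intro cv.span_mono) auto
  have "r \<in> cspan (insert b B)"
    unfolding r_def using p sub by (intro cv.span_diff) (auto intro: cv.span_base)
  then have y': "y' \<in> cspan (insert b B)"
    unfolding y'_def using y sub by (intro cv.span_add cv.span_scale) auto
  have diff: "x - y' = (x - y) - cscale c r" by (simp add: y'_def algebra_simps)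
  have oB: "cinner n (x - y') z = 0" if "z \<in> cspan B" for z
    using that y p unfolding diff by (simp add: cinner_diff_left[of n "x - y"] cinner_scale_left r_def)
  have "cinner n (x - y') r = 0"
  proof (cases "cinner n r r = 0")
    \<comment> \<open>\<open>B\<close> may be dependent and \<open>cinner n\<close> ignores entries
      from \<open>n\<close> on, so \<open>r\<close> can be null; it is then orthogonal to every
      vector.\<close>
    case True
    then have "cinner n v r = 0" for v
      using cinner_self_eq_0[OF True] by (simp add: cinner_def)
    then show ?thesis .
  next
    case False
    then show ?thesis
      unfolding diff by (simp add: cinner_diff_left[of n "x - y"] cinner_scale_left c_def)
  qed
  moreover have "b = p + r" by (simp add: r_def)
  ultimately have ob: "cinner n (x - y') b = 0" using oB p(1) by (simp add: cinner_add_right)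
  have "cspan (insert b B) \<subseteq> {z. cinner n (x - y') z = 0}"
    using ob oB cv.span_base by (intro cv.span_minimal subspace_orthogonal) blast
  then show ?case using y' by blast
qed

lemma orthogonal_projection_exists:
  assumes "cv.subspace S" "S \<subseteq> cvec n"
  shows "\<exists>y\<in>S. \<forall>z\<in>S. cinner n (x - y) z = 0"
proof -
  obtain B where B: "B \<subseteq> S" "S \<subseteq> cspan B" "finite B"
    using cv.finite_basis_exists[of S "unit_vec ` {..<n}"] assms(2) cvec_finite_span[of n]
    by (metis finite_imageI finite_lessThan order_trans)
  then have "cspan B = S" using assms(1) cv.span_minimal by blast
  then show ?thesis using orthogonal_projection_exists_span[OF B(3)] by metis
qed

text \<open>Two candidates differ by a vector of \<open>S\<close> orthogonal to itself. Its first
  \<open>n\<close> entries vanish by definiteness, the others by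
  \<open>S \<subseteq> cvec n\<close>.\<close>

lemma proj_eqI:
  assumes "cv.subspace S" "S \<subseteq> cvec n" "y \<in> S" "\<And>z. z \<in> S \<Longrightarrow> cinner n (x - y) z = 0"
  shows "proj n S x = y"
  unfolding proj_def
proof (rule the_equality)
  fix w assume w: "w \<in> S \<and> (\<forall>z\<in>S. cinner n (x - w) z = 0)"
  then have d: "w - y \<in> S" using assms cv.subspace_diff by blast
  have "cinner n (w - y) (w - y) = cinner n ((x - y) - (x - w)) (w - y)" by simp
  also have "\<dots> = 0" using w d assms(4) by (simp only: cinner_diff_left[of n "x - y"]) simp
  finally have "(w - y) t = 0" if "t < n" for t using cinner_self_eq_0 that by blast
  moreover have "(w - y) t = 0" if "\<not> t < n" for t
    using that d assms(2) by (auto simp: cvec_def)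
  ultimately have "(w - y) t = 0" for t by blast
  then show "w = y" by (auto simp: fun_eq_iff)
qed (use assms in auto)

lemma proj_mem_orth:
  assumes "cv.subspace S" "S \<subseteq> cvec n"
  shows "proj n S x \<in> S" "z \<in> S \<Longrightarrow> cinner n (x - proj n S x) z = 0"
proof -
  obtain y where y: "y \<in> S" "\<And>z. z \<in> S \<Longrightarrow> cinner n (x - y) z = 0"
    using orthogonal_projection_exists[OF assms, of x] by blast
  then have "proj n S x = y" by (intro proj_eqI[OF assms])
  with y show "proj n S x \<in> S" "z \<in> S \<Longrightarrow> cinner n (x - proj n S x) z = 0" by simp_all
qed

lemma linear_proj:
  assumes "cv.subspace S" "S \<subseteq> cvec n"
  shows "Vector_Spaces.linear cscale cscale (proj n S)"
proof -
  have add: "proj n S (x + y) = proj n S x + proj n S y" for x y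
  proof (rule proj_eqI[OF assms])
    show "proj n S x + proj n S y \<in> S"
      using proj_mem_orth(1)[OF assms] by (intro cv.subspace_add assms(1))
    have "x + y - (proj n S x + proj n S y) = (x - proj n S x) + (y - proj n S y)" by simp
    then show "cinner n (x + y - (proj n S x + proj n S y)) z = 0" if "z \<in> S" for z
      using proj_mem_orth(2)[OF assms that] by (simp only: cinner_add_left) simp
  qed
  have scale: "proj n S (cscale c x) = cscale c (proj n S x)" for c x
  proof (rule proj_eqI[OF assms])
    show "cscale c (proj n S x) \<in> S"
      using proj_mem_orth(1)[OF assms] by (intro cv.subspace_scale assms(1))
    have "cscale c x - cscale c (proj n S x) = cscale c (x - proj n S x)"
      by (simp add: cv.scale_right_diff_distrib)
    then show "cinner n (cscale c x - cscale c (proj n S x)) z = 0" if "z \<in> S" for z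
      using proj_mem_orth(2)[OF assms that] by (simp only: cinner_scale_left) simp
  qed
  show ?thesis by unfold_locales (use add scale in auto)
qed

lemma subspace_orth_compl: "cv.subspace (orth_compl n I)"
  unfolding cv.subspace_def
proof (intro conjI ballI allI)
  show "0 \<in> orth_compl n I" by (simp add: orth_compl_def cvec_def cinner_def)
qed (auto simp: orth_compl_def cinner_add_left cinner_scale_left
    cv.subspace_add[OF subspace_cvec] cv.subspace_scale[OF subspace_cvec])

lemma orth_compl_subset: "orth_compl n I \<subseteq> cvec n"
  by (auto simp: orth_compl_def)

section \<open>Consequences of decodability\<close>

lemma colspan_GV_cvec: "colspan_GV n m V g k j \<subseteq> cvec n"
  unfolding colspan_GV_def
  by (intro cv.span_minimal subspace_cvec) (auto simp: rx_col_def cvec_def)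

lemma colspan_V_cvec: "colspan_V n m V g j \<subseteq> cvec n"
  unfolding colspan_V_def
  by (intro cv.span_minimal subspace_cvec) (auto simp: enc_col_def cvec_def)

lemma decodable_dim_colspan_V:
  "decodable n m V g \<Longrightarrow> j < 3 \<Longrightarrow> cdim (colspan_V n m V g j) = m j"
  by (simp add: decodable_def)

text \<open>An interference vector projects to \<open>0\<close>, while decodability makes the
  projection injective on the desired signal space, since the image has dimension \<open>m k\<close>
  and there are at most \<open>m k\<close> columns.\<close>

lemma decodable_signal_interference_disjoint:
  assumes "decodable n m V g" "k < 3" "i < 3" "i \<noteq> k"
    and "z \<in> colspan_GV n m V g k k" "z \<in> colspan_GV n m V g k i"
  shows "z = 0"
proof -
  define S where "S = orth_compl n (interf n m V g k)"
  have S: "cv.subspace S" "S \<subseteq> cvec n"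
    by (auto simp: S_def subspace_orth_compl orth_compl_subset[THEN subsetD])
  let ?C = "{rx_col n V g k k i | i. i < m k}"
  have C: "?C = rx_col n V g k k ` {..<m k}" by auto
  have "card ?C \<le> m k" unfolding C using card_image_le[of "{..<m k}"] by simp
  also have "m k = cdim (proj n S ` cspan ?C)"
    using assms by (simp add: decodable_def S_def colspan_GV_def)
  finally have card: "card ?C \<le> cdim (proj n S ` cspan ?C)" .
  have "i \<in> {0,1,2}" using assms(3) by auto
  then have "z \<in> interf n m V g k" using assms(4,6) by (auto simp: interf_def)
  then have "cinner n w z = 0" if "w \<in> S" for w
    using that by (auto simp: S_def orth_compl_def)
  then have "cinner n z w = 0" if "w \<in> S" for w
    using that cinner_commute[of n z w] by simp
  then have 0: "proj n S z = 0"
    using S cv.subspace_0[OF S(1)] by (intro proj_eqI) (simp_all del: zero_fun_def)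
  have "finite ?C" by (simp add: C)
  then show ?thesis
    using cv.linear_kernel_trivial_of_dim_image[OF linear_proj[OF S] _ card _ 0] assms(5)
    unfolding colspan_GV_def by blast
qed

text \<open>The projected desired signal occupies \<open>m k\<close> dimensions of the orthogonal
  complement \<open>S\<close>. Although \<open>interf\<close> is a union, \<open>S\<close> is
  orthogonal to the whole sum \<open>W\<close>, so the dimensions of \<open>S\<close> and
  \<open>W\<close> add up within \<open>n\<close>.\<close>

lemma decodable_dim_interference:
  assumes "decodable n m V g" "k < 3" "i < 3" "j < 3" "i \<noteq> k" "j \<noteq> k"
  shows "m k + cdim {x + y | x y. x \<in> colspan_GV n m V g k i \<and> y \<in> colspan_GV n m V g k j} \<le> n"
proof -
  define S where "S = orth_compl n (interf n m V g k)"
  define W where "W = {x + y | x y. x \<in> colspan_GV n m V g k i \<and> y \<in> colspan_GV n m V g k j}"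
  have S: "cv.subspace S" "S \<subseteq> cvec n"
    by (auto simp: S_def subspace_orth_compl orth_compl_subset[THEN subsetD])
  have W: "cv.subspace W"
    unfolding W_def colspan_GV_def by (intro cv.subspace_sums cv.subspace_span)
  have Wn: "W \<subseteq> cvec n"
    using colspan_GV_cvec[of n m V g k] cv.subspace_add[OF subspace_cvec] unfolding W_def by blast
  have "m k = cdim (proj n S ` colspan_GV n m V g k k)"
    using assms by (simp add: decodable_def S_def)
  also have "\<dots> \<le> cdim S"
    using S proj_mem_orth(1) by (intro dim_mono_cvec) auto
  finally have mk: "m k \<le> cdim S" .
  have "S \<inter> W \<subseteq> {0}"
  proof
    fix w assume w: "w \<in> S \<inter> W"
    then obtain x y where xy: "w = x + y" "x \<in> colspan_GV n m V g k i" "y \<in> colspan_GV n m V g k j"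
      by (auto simp: W_def)
    have "i \<in> {0,1,2}" "j \<in> {0,1,2}" using assms by auto
    then have "x \<in> interf n m V g k" "y \<in> interf n m V g k" using xy assms by (auto simp: interf_def)
    then have "cinner n w x = 0" "cinner n w y = 0" using w by (auto simp: S_def orth_compl_def)
    then have "cinner n w w = 0" using xy(1) by (metis add_0 cinner_add_right)
    then have "w t = 0" for t using cinner_self_eq_0[of n w t] w S(2) by (cases "t < n") (auto simp: cvec_def)
    then show "w \<in> {0}" by auto
  qed
  then have "cdim (S \<inter> W) = 0"
    using cv.dim_le_card[of "S \<inter> W" "{}"] by simp
  then have "cdim S + cdim W \<le> cdim {x + y | x y. x \<in> S \<and> y \<in> W}"
    using dim_add_le_cvec[OF S(1) W S(2) Wn] by simp
  also have "\<dots> \<le> card {..<n}"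
  proof (rule dim_supported_le)
    fix x t assume "x \<in> {x + y | x y. x \<in> S \<and> y \<in> W}" "t \<notin> {..<n}"
    then show "x t = 0" using S(2) Wn by (auto simp: cvec_def subset_iff)
  qed simp
  finally show ?thesis using mk by (simp add: W_def)
qed

section \<open>Generic channel realisations\<close>

text \<open>Fubini for null sets, valid for an arbitrary predicate \<open>P\<close>. The two factors
  are swapped so that the new coordinate is drawn last.\<close>

lemma AE_PiM_insert:
  fixes \<mu> :: "'a measure"
  assumes "prob_space \<mu>" "AE g in PiM (insert i I) (\<lambda>_. \<mu>). P g"
  shows "AE y in PiM I (\<lambda>_. \<mu>). AE x in \<mu>. P (y(i := x))"
proof -
  let ?M = "PiM I (\<lambda>_. \<mu>)" and ?N = "PiM (insert i I) (\<lambda>_. \<mu>)"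
  interpret mu: prob_space \<mu> by fact
  interpret M: prob_space ?M by (intro prob_space_PiM assms(1))
  interpret pair_sigma_finite ?M \<mu> ..
  interpret swap: pair_sigma_finite \<mu> ?M ..
  have "AE g in distr (\<mu> \<Otimes>\<^sub>M ?M) ?N (\<lambda>(x, X). X(i := x)). P g"
    using assms(2) by (subst distr_pair_PiM_eq_PiM) (auto intro: assms(1))
  then have "AE p in \<mu> \<Otimes>\<^sub>M ?M. P ((\<lambda>(x, X). X(i := x)) p)"
    by (rule AE_distrD[rotated]) measurable
  then have "AE p in distr (?M \<Otimes>\<^sub>M \<mu>) (\<mu> \<Otimes>\<^sub>M ?M) (\<lambda>(x, y). (y, x)). P ((\<lambda>(x, X). X(i := x)) p)"
    by (simp only: swap.distr_pair_swap[symmetric])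
  then have "AE p in ?M \<Otimes>\<^sub>M \<mu>. P ((\<lambda>(x, X). X(i := x)) ((\<lambda>(x, y). (y, x)) p))"
    by (rule AE_distrD[rotated]) measurable
  from AE_pair[OF this] show ?thesis by simp
qed

text \<open>The coordinates are chosen one after the other, so \<open>bad\<close> need not be jointly measurable.\<close>

lemma exists_generic_point:
  fixes \<mu> :: "'a measure" and f :: "'i \<Rightarrow> nat"
  assumes mu: "prob_space \<mu>" "\<And>F. finite F \<Longrightarrow> AE x in \<mu>. x \<notin> F"
    and "finite I" "inj_on f I" "AE g in PiM I (\<lambda>_. \<mu>). P g"
    and "\<And>i g. finite (bad g i)"
    and "\<And>i g g'. i \<in> I \<Longrightarrow> (\<And>l. l \<in> I \<Longrightarrow> f l < f i \<Longrightarrow> g l = g' l) \<Longrightarrow> bad g i = bad g' i"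
  shows "\<exists>g. P g \<and> (\<forall>i\<in>I. g i \<notin> bad g i)"
  using assms(3-)
proof (induction I arbitrary: P rule: finite_ranking_induct[where f = f])
  case empty
  interpret prob_space "PiM {} (\<lambda>_. \<mu>) :: ('i \<Rightarrow> 'a) measure" by (intro prob_space_PiM mu)
  show ?case using eventually_happens[OF empty.prems(2)] ae_filter_bot by auto
next
  case (insert i I)
  show ?case
  proof (cases "i \<in> I")
    \<comment> \<open>The ranking induction does not supply freshness of \<open>i\<close>.\<close>
    case True
    then have eq: "insert i I = I" by auto
    show ?thesis unfolding eq by (rule insert.IH) (fact insert.prems[unfolded eq])+
  next
    case False
    have less: "f l < f i" if "l \<in> I" for l
    proof -
      have "f l \<noteq> f i" using insert.prems(1) that False by (auto simp: inj_on_def)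
      then show ?thesis using insert.hyps(2)[OF that] by simp
    qed
    have I: "bad g l = bad g' l" if "l \<in> I" "\<And>k. k \<in> I \<Longrightarrow> f k < f l \<Longrightarrow> g k = g' k" for g g' l
    proof (rule insert.prems(4))
      show "l \<in> insert i I" using that(1) by simp
      show "g k = g' k" if k: "k \<in> insert i I" "f k < f l" for k
      proof -
        have "k \<noteq> i" using less[OF \<open>l \<in> I\<close>] k(2) by auto
        then show ?thesis using k \<open>\<And>k. k \<in> I \<Longrightarrow> f k < f l \<Longrightarrow> g k = g' k\<close> by simp
      qed
    qed
    \<comment> \<open>The induction hypothesis is used with \<open>P\<close> replaced by its
      validity for almost every value at \<open>i\<close>. That value then only has to avoid a null
      set and a finite set, both fixed by \<open>y\<close>.\<close>
    have "\<exists>y. (AE x in \<mu>. P (y(i := x))) \<and> (\<forall>l\<in>I. y l \<notin> bad y l)"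
    proof (rule insert.IH)
      show "inj_on f I" using insert.prems(1) by simp
      show "AE y in PiM I (\<lambda>_. \<mu>). AE x in \<mu>. P (y(i := x))"
        using AE_PiM_insert[OF mu(1) insert.prems(2)] .
      show "finite (bad g l)" for g l by (rule insert.prems(3))
    qed (rule I)
    then obtain y where y: "AE x in \<mu>. P (y(i := x))" "\<forall>l\<in>I. y l \<notin> bad y l" by blast
    interpret prob_space \<mu> by (rule mu)
    have "AE x in \<mu>. P (y(i := x)) \<and> x \<notin> bad y i"
      using y(1) mu(2)[OF insert.prems(3)] by (rule AE_conjI)
    then obtain x where x: "P (y(i := x))" "x \<notin> bad y i"
      using eventually_happens ae_filter_bot by blast
    have "bad (y(i := x)) i = bad y i" using False by (intro insert.prems(4)) auto
    moreover have "bad (y(i := x)) l = bad y l" if "l \<in> I" for l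
      using that False by (intro I) auto
    ultimately have "\<forall>l\<in>insert i I. (y(i := x)) l \<notin> bad (y(i := x)) l"
      using x(2) y(2) False by auto
    then show ?thesis using x(1) by blast
  qed
qed

section \<open>Excluded channel coefficients\<close>

definition tx_sig :: "(nat \<Rightarrow> nat) \<Rightarrow> scheme \<Rightarrow> chan \<Rightarrow> nat \<Rightarrow> nat \<Rightarrow> (nat \<Rightarrow> complex) \<Rightarrow> complex" where
  "tx_sig m V g j t x = (\<Sum>i<m j. V j t g i * x i)"

text \<open>Symbol vectors are used instead of signals: under delayed CSIT this set is fixed by the
  coefficients before time \<open>t\<close>, whereas the column spans depend on the whole
  block.\<close>

definition rx_null :: "(nat \<Rightarrow> nat) \<Rightarrow> scheme \<Rightarrow> chan \<Rightarrow> nat \<Rightarrow> nat \<Rightarrow> nat \<Rightarrow> nat \<Rightarrow>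
    ((nat \<Rightarrow> complex) \<times> (nat \<Rightarrow> complex)) set" where
  "rx_null m V g k i j t =
    {(x, y). \<forall>s<t. g (s, k, i) * tx_sig m V g i s x + g (s, k, j) * tx_sig m V g j s y = 0}"

text \<open>A single null pair with nonzero observation already makes time \<open>t\<close> a new
  one, so one chosen pair, and hence one excluded value, suffices for each \<open>i\<close>.\<close>

definition rx_witness :: "(nat \<Rightarrow> nat) \<Rightarrow> scheme \<Rightarrow> chan \<Rightarrow> nat \<Rightarrow> nat \<Rightarrow> nat \<Rightarrow> nat \<Rightarrow>
    (nat \<Rightarrow> complex) \<times> (nat \<Rightarrow> complex)" where
  "rx_witness m V g k i j t =
    (SOME p. p \<in> rx_null m V g k i j t \<and> tx_sig m V g j t (snd p) \<noteq> 0)"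

text \<open>Besides \<open>0\<close>, the values of \<open>g (t, k, j)\<close> for which the observation at time \<open>t\<close> fails to
  separate the witness from \<open>0\<close>. If no witness exists, the excluded values are junk, which is
  harmless because only finitely many values are excluded.\<close>

definition bad_coeffs :: "(nat \<Rightarrow> nat) \<Rightarrow> scheme \<Rightarrow> chan \<Rightarrow> nat \<times> nat \<times> nat \<Rightarrow> complex set" where
  "bad_coeffs m V g = (\<lambda>(t, k, j). insert 0 ((\<lambda>i.
     - g (t, k, i) * tx_sig m V g i t (fst (rx_witness m V g k i j t))
       / tx_sig m V g j t (snd (rx_witness m V g k i j t))) ` {..<j}))"

text \<open>The order is lexicographic in time, receiver, transmitter. Beamforming at time
  \<open>t\<close> uses earlier times, and the excluded values involve \<open>g (t, k, i)\<close>
  only for \<open>i < j\<close>, so all of this is fixed before \<open>g (t, k, j)\<close> is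
  chosen.\<close>

lemma bad_coeffs_cong:
  assumes "delayed_csit n V" "t < n" "k < 3" "j < 3"
    and eq: "\<And>s l i. s \<le> t \<Longrightarrow> l < 3 \<Longrightarrow> i < 3 \<Longrightarrow> 9 * s + 3 * l + i < 9 * t + 3 * k + j \<Longrightarrow>
      g (s, l, i) = g' (s, l, i)"
  shows "bad_coeffs m V g (t, k, j) = bad_coeffs m V g' (t, k, j)"
proof -
  have past: "g (s, l, i) = g' (s, l, i)" if "s < t" "l < 3" "i < 3" for s l i
    using that by (intro eq) auto
  have "V i s g = V i s g'" if "i < 3" "s \<le> t" for i s
  proof -
    have "s < n" "\<forall>s'<s. \<forall>l<3. \<forall>i<3. g (s', l, i) = g' (s', l, i)"
      using that assms(2) past by auto
    then show ?thesis using assms(1) that(1) unfolding delayed_csit_def by blast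
  qed
  then have tx: "tx_sig m V g i s = tx_sig m V g' i s" if "i < 3" "s \<le> t" for i s
    using that by (simp add: tx_sig_def fun_eq_iff)
  have null: "rx_null m V g k i j t = rx_null m V g' k i j t" if "i < j" for i
    unfolding rx_null_def using that assms(3,4) by (auto simp: tx past)
  have wit: "rx_witness m V g k i j t = rx_witness m V g' k i j t" if "i < j" for i
    unfolding rx_witness_def using null[OF that] tx[of j t] assms(4) by simp
  show ?thesis
    unfolding bad_coeffs_def prod.case
    using assms(3,4) by (intro arg_cong[where f = "insert 0"] image_cong refl)
      (auto simp: tx wit eq)
qed

text \<open>If \<open>j\<close> sent something nonzero on a null pair, the witness would have this
  property too, and its observation could vanish only at the excluded value of
  \<open>g (t, k, j)\<close>. With the signal of \<open>j\<close> gone,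
  \<open>g (t, k, i) \<noteq> 0\<close> removes that of \<open>i\<close>.\<close>

lemma generic_observation:
  assumes "g (t, k, i) \<noteq> 0" "g (t, k, j) \<notin> bad_coeffs m V g (t, k, j)" "i < j"
    and null: "\<And>x y. (x, y) \<in> rx_null m V g k i j t \<Longrightarrow>
      g (t, k, i) * tx_sig m V g i t x + g (t, k, j) * tx_sig m V g j t y = 0"
    and xy: "(x, y) \<in> rx_null m V g k i j t"
  shows "tx_sig m V g i t x = 0 \<and> tx_sig m V g j t y = 0"
proof -
  have "tx_sig m V g j t y = 0"
  proof (rule ccontr)
    assume "tx_sig m V g j t y \<noteq> 0"
    then have "\<exists>p. p \<in> rx_null m V g k i j t \<and> tx_sig m V g j t (snd p) \<noteq> 0" using xy by force
    then have w: "rx_witness m V g k i j t \<in> rx_null m V g k i j t"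
      "tx_sig m V g j t (snd (rx_witness m V g k i j t)) \<noteq> 0"
      unfolding rx_witness_def by (metis (mono_tags, lifting) someI_ex)+
    have "g (t, k, j) \<noteq> - g (t, k, i) * tx_sig m V g i t (fst (rx_witness m V g k i j t))
       / tx_sig m V g j t (snd (rx_witness m V g k i j t))"
      using assms(2,3) by (auto simp: bad_coeffs_def)
    moreover have "g (t, k, i) * tx_sig m V g i t (fst (rx_witness m V g k i j t))
      + g (t, k, j) * tx_sig m V g j t (snd (rx_witness m V g k i j t)) = 0"
      using w(1) by (intro null) simp
    ultimately show False using w(2) by (simp add: field_simps eq_neg_iff_add_eq_0)
  qed
  then show ?thesis using null[OF xy] assms(1) by simp
qed

section \<open>Bounds on the symbol counts\<close>

lemma colspan_V_eq_range:
  "colspan_V n m V g j = range (\<lambda>x t. if t < n then tx_sig m V g j t x else 0)"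
    (is "_ = range ?f")
proof
  have "Vector_Spaces.linear cscale cscale ?f"
    by unfold_locales (auto simp: cscale_def tx_sig_def fun_eq_iff algebra_simps sum.distrib
        sum_distrib_left)
  then interpret f: Vector_Spaces.linear cscale cscale ?f .
  have "enc_col n V g j i = ?f (unit_vec i)" if "i < m j" for i
    using that by (auto simp: enc_col_def tx_sig_def unit_vec_def fun_eq_iff if_distrib
        sum.If_cases cong: if_cong)
  then show "colspan_V n m V g j \<subseteq> range ?f"
    unfolding colspan_V_def
    using f.subspace_image[OF cv.subspace_UNIV] by (intro cv.span_minimal) auto
  show "range ?f \<subseteq> colspan_V n m V g j"
  proof safe
    fix x
    have "?f x = (\<Sum>i<m j. cscale (x i) (enc_col n V g j i))"
    proof
      fix t
      have "(\<Sum>i<k. cscale (x i) (enc_col n V g j i)) t =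
          (\<Sum>i<k. cscale (x i) (enc_col n V g j i) t)" for k
        by (induction k) auto
      then show "?f x t = (\<Sum>i<m j. cscale (x i) (enc_col n V g j i)) t"
        by (simp add: cscale_def enc_col_def tx_sig_def mult.commute)
    qed
    also have "\<dots> \<in> colspan_V n m V g j"
      unfolding colspan_V_def by (intro cv.span_sum cv.span_scale cv.span_base) auto
    finally show "?f x \<in> colspan_V n m V g j" .
  qed
qed

text \<open>The multiplier is \<open>1\<close> from index \<open>n\<close> on, where all signals
  vanish; nonzero coefficients then make it nowhere zero, as \<open>rank_ratio\<close>
  demands.\<close>

lemma colspan_GV_eq_image:
  "colspan_GV n m V g k j =
    (\<lambda>x. (\<lambda>t. if t < n then g (t, k, j) else 1) * x) ` colspan_V n m V g j"
proof -
  let ?f = "\<lambda>x. (\<lambda>t. if t < n then g (t, k, j) else 1) * x"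
  interpret f: Vector_Spaces.linear cscale cscale ?f by (rule linear_times)
  have "rx_col n V g k j i = ?f (enc_col n V g j i)" for i
    by (auto simp: rx_col_def enc_col_def fun_eq_iff)
  then have "{rx_col n V g k j i | i. i < m j} = ?f ` {enc_col n V g j i | i. i < m j}"
    by auto
  then show ?thesis unfolding colspan_GV_def colspan_V_def by (simp only: cspan_def f.span_image)
qed

text \<open>Receiver \<open>k\<close> observes, and receiver \<open>j\<close> separates because it
  decodes its own signal against the interference from \<open>i\<close>. The order
  \<open>i < j\<close> matches the range of \<open>i\<close> in \<open>bad_coeffs\<close>.\<close>

lemma interference_dim_bound:
  assumes dec: "decodable n m V g"
    and good: "\<And>t k j. t < n \<Longrightarrow> k < 3 \<Longrightarrow> j < 3 \<Longrightarrow> g (t, k, j) \<notin> bad_coeffs m V g (t, k, j)"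
    and k: "k < 3" "j < 3" "i < j" "i \<noteq> k" "j \<noteq> k"
  shows "2 * (m i + m j) + 3 * m k \<le> 3 * n"
proof -
  define c where "c k i t = (if t < n then g (t, k, i) else 1)" for k i t
  have nz: "g (t, k, j) \<noteq> 0" if "t < n" "k < 3" "j < 3" for t k j
    using good[OF that] by (auto simp: bad_coeffs_def)
  then have c: "c k i t \<noteq> 0" if "k < 3" "i < 3" for k i t
    using that by (simp add: c_def)
  let ?U = "colspan_V n m V g"
  have GV: "colspan_GV n m V g k i = (\<lambda>x. c k i * x) ` ?U i" for k i
    unfolding colspan_GV_eq_image c_def ..
  have sub: "cv.subspace (?U i)" for i unfolding colspan_V_def by (rule cv.subspace_span)
  have sig: "x \<in> ?U i \<longleftrightarrow> (\<exists>u. x = (\<lambda>t. if t < n then tx_sig m V g i t u else 0))" for x i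
    unfolding colspan_V_eq_range by auto
  have "2 * (cdim (?U i) + cdim (?U j)) \<le>
    3 * cdim {x + y | x y. x \<in> (\<lambda>x. c k i * x) ` ?U i \<and> y \<in> (\<lambda>x. c k j * x) ` ?U j}"
  proof (rule rank_ratio[where a' = "c j i" and b' = "c j j"])
    fix x y assume xy: "x \<in> ?U i" "y \<in> ?U j" "c j i * x = c j j * y"
    have "c j i * x \<in> colspan_GV n m V g j i" "c j i * x \<in> colspan_GV n m V g j j"
      using xy(1,2) unfolding GV by (simp, simp add: xy(3))
    then have "c j i * x = 0"
      using dec k by (intro decodable_signal_interference_disjoint[of n m V g j i]) auto
    then show "x = 0" using c[of j i] k by (auto simp: fun_eq_iff)
  next
    fix t assume t: "t < n"
    assume H: "\<forall>x\<in>?U i. \<forall>y\<in>?U j. (\<forall>s<t. c k i s * x s + c k j s * y s = 0) \<longrightarrow>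
      c k i t * x t + c k j t * y t = 0"
    have null: "g (t, k, i) * tx_sig m V g i t u + g (t, k, j) * tx_sig m V g j t v = 0"
      if "(u, v) \<in> rx_null m V g k i j t" for u v
    proof -
      define x where "x = (\<lambda>t. if t < n then tx_sig m V g i t u else 0)"
      define y where "y = (\<lambda>t. if t < n then tx_sig m V g j t v else 0)"
      have "x \<in> ?U i" "y \<in> ?U j" unfolding x_def y_def using sig by blast+
      moreover have "\<forall>s<t. c k i s * x s + c k j s * y s = 0"
        using that t by (simp add: rx_null_def c_def x_def y_def)
      ultimately have "c k i t * x t + c k j t * y t = 0" using H by blast
      then show ?thesis using t by (simp add: c_def x_def y_def)
    qed
    show "\<forall>x\<in>?U i. \<forall>y\<in>?U j. (\<forall>s<t. c k i s * x s + c k j s * y s = 0) \<longrightarrow> x t = 0 \<and> y t = 0"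
    proof (intro ballI impI)
      fix x y assume "x \<in> ?U i" "y \<in> ?U j" and z: "\<forall>s<t. c k i s * x s + c k j s * y s = 0"
      then obtain u v where uv: "x = (\<lambda>t. if t < n then tx_sig m V g i t u else 0)"
        "y = (\<lambda>t. if t < n then tx_sig m V g j t v else 0)" using sig by blast
      have "(u, v) \<in> rx_null m V g k i j t"
        using z t unfolding rx_null_def uv c_def by simp
      then have "tx_sig m V g i t u = 0 \<and> tx_sig m V g j t v = 0"
        using k t nz good null by (intro generic_observation[of g t k i j m V u v]) auto
      then show "x t = 0 \<and> y t = 0" using uv by simp
    qed
  qed (use c k sub colspan_V_cvec in \<open>auto simp del: times_fun_apply\<close>)
  then have "2 * (m i + m j) \<le>
      3 * cdim {x + y | x y. x \<in> colspan_GV n m V g k i \<and> y \<in> colspan_GV n m V g k j}"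
    using decodable_dim_colspan_V[OF dec] k by (simp add: GV)
  moreover have "m k + cdim {x + y | x y. x \<in> colspan_GV n m V g k i \<and> y \<in> colspan_GV n m V g k j} \<le> n"
    using dec k by (intro decodable_dim_interference) auto
  ultimately show ?thesis by linarith
qed

lemma symbol_count_bound:
  fixes \<mu> :: "complex measure"
  assumes mu: "prob_space \<mu>" "absolutely_continuous lborel \<mu>"
    and V: "delayed_csit n V" "AE g in chan_measure \<mu> n. decodable n m V g"
  shows "7 * (m 0 + m 1 + m 2) \<le> 9 * n"
proof -
  let ?I = "{..<n} \<times> {..<3 :: nat} \<times> {..<3 :: nat}"
  let ?f = "\<lambda>(t, k, j). 9 * t + 3 * k + j :: nat"
  have "\<exists>g. decodable n m V g \<and> (\<forall>p\<in>?I. g p \<notin> bad_coeffs m V g p)"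
  proof (rule exists_generic_point[OF mu(1), where f = ?f])
    fix F :: "complex set" assume "finite F"
    then have "F \<in> null_sets lborel" by (rule finite_imp_null_set_lborel)
    then have "F \<in> null_sets \<mu>" using mu(2) by (auto simp: absolutely_continuous_def)
    then show "AE x in \<mu>. x \<notin> F" by (rule AE_not_in)
  next
    have inj: "t = t' \<and> k = k' \<and> j = j'"
      if "9 * t + 3 * k + j = 9 * t' + 3 * k' + j'" "k < 3" "j < 3" "k' < 3" "j' < 3"
      for t k j t' k' j' :: nat
    proof -
      have t: "t = t'" using that by linarith
      then have k: "k = k'" using that by linarith
      then show ?thesis using that(1) unfolding t k by simp
    qed
    show "inj_on ?f ?I"
    proof (rule inj_onI)
      fix p q assume pq: "p \<in> ?I" "q \<in> ?I" "?f p = ?f q"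
      obtain t k j t' k' j' where "p = (t, k, j)" "q = (t', k', j')" by (cases p, cases q)
      then show "p = q" using inj[of t k j t' k' j'] pq by simp
    qed
    show "AE g in PiM ?I (\<lambda>_. \<mu>). decodable n m V g"
      using V(2) unfolding chan_measure_def .
    show "finite (bad_coeffs m V g p)" for g p by (cases p) (simp add: bad_coeffs_def)
    fix p and g g' :: chan
    assume p: "p \<in> ?I" and eq: "\<And>l. l \<in> ?I \<Longrightarrow> ?f l < ?f p \<Longrightarrow> g l = g' l"
    obtain t k j where tkj: "p = (t, k, j)" by (cases p)
    show "bad_coeffs m V g p = bad_coeffs m V g' p"
      unfolding tkj using p V(1)
    proof (intro bad_coeffs_cong)
      fix s l i assume "s \<le> t" "l < 3" "i < 3" "9 * s + 3 * l + i < 9 * t + 3 * k + j"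
      then show "g (s, l, i) = g' (s, l, i)" using p by (intro eq) (auto simp: tkj)
    qed (auto simp: tkj)
  qed simp
  then obtain g where dec: "decodable n m V g" and good: "\<forall>p\<in>?I. g p \<notin> bad_coeffs m V g p"
    by blast
  have "2 * (m i + m j) + 3 * m k \<le> 3 * n" if "k < 3" "j < 3" "i < j" "i \<noteq> k" "j \<noteq> k" for i j k
    using dec that good by (intro interference_dim_bound[of n m V g]) auto
  \<comment> \<open>The instances list \<open>k\<close>, \<open>j\<close>, \<open>i\<close>. In the
    sum each user has weight 3 once, as receiver, and weight 2 twice, as interferer: 7 in
    total.\<close>
  from this[of 0 2 1] this[of 1 2 0] this[of 2 1 0] show ?thesis by simp
qed

theorem theorem2:
  fixes \<mu> :: "complex measure"
  assumes "prob_space \<mu>"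
    and "sets \<mu> = sets borel"
    and "absolutely_continuous lborel \<mu>"
  shows "\<forall>(d1, d2, d3) \<in> D_3UserIC \<mu>. d1 + d2 + d3 \<le> 9 / 7"
proof -
  \<comment> \<open>A closed half-space, so the bound survives the closure in
    \<open>D_3UserIC\<close>.\<close>
  let ?H = "{d :: real \<times> real \<times> real. fst d + fst (snd d) + snd (snd d) \<le> 9 / 7}"
  have "{d. lin_achievable \<mu> d} \<subseteq> ?H"
  proof safe
    fix d1 d2 d3 :: real assume "lin_achievable \<mu> (d1, d2, d3)"
    then obtain m V where
      V: "\<And>n. delayed_csit n (V n)" "\<And>n. AE g in chan_measure \<mu> n. decodable n (m n) (V n) g"
      and lim: "(\<lambda>n. real (m n 0) / real n) \<longlonglongrightarrow> d1" "(\<lambda>n. real (m n 1) / real n) \<longlonglongrightarrow> d2"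
        "(\<lambda>n. real (m n 2) / real n) \<longlonglongrightarrow> d3"
      unfolding lin_achievable_def by auto
    have "real (m n 0) / real n + real (m n 1) / real n + real (m n 2) / real n \<le> 9 / 7" for n
    \<comment> \<open>For \<open>n = 0\<close> the quotients are \<open>0\<close> by the convention
      for division by zero.\<close>
    proof (cases "n = 0")
      case False
      have "real (7 * (m n 0 + m n 1 + m n 2)) \<le> real (9 * n)"
        using symbol_count_bound[OF assms(1,3) V] of_nat_le_iff by blast
      then show ?thesis using False by (simp add: field_simps)
    qed simp
    then have "d1 + d2 + d3 \<le> 9 / 7"
      by (intro LIMSEQ_le_const2[OF tendsto_add[OF tendsto_add[OF lim(1,2)] lim(3)]]) auto
    then show "fst (d1, d2, d3) + fst (snd (d1, d2, d3)) + snd (snd (d1, d2, d3)) \<le> 9 / 7"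
      by simp
  qed
  moreover have "closed ?H"
    by (intro closed_Collect_le continuous_intros)
  ultimately have "D_3UserIC \<mu> \<subseteq> ?H"
    unfolding D_3UserIC_def by (rule closure_minimal)
  then show ?thesis by force
qed

end
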